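(* Let $\Omega \subset \mathbb{R}^n$ be a domain, let $N := \dim \mathbb{P}_d(\Omega)$, and let $\{K_i\}_{i=1}^N$ be a collection of compact sets contained in $\Omega$ which is unisolvent for $\mathbb{P}_d(\mathbb{R}^n)$. If $K_i \cap K_j = \emptyset$ for $i \neq j$, then $$\Vert \Pi \Vert_{\mathrm{op}} = \Lambda_d .$$
   Context: Let $\mathbb{P}_d(\Omega)$ be the space of (restrictions to $\Omega$ of) real polynomials in $n$ variables of total degree at most $d$, identified with $\mathbb{P}_d(\mathbb{R}^n)$; $\mu$ is Lebesgue measure. Throughout, "compact set" means the closure $K$ of an open connected set $U \subset \mathbb{R}^n$ with $0 < \mu(K) = \mu(U) < +\infty$. A collection $\{K_1,\dots,K_N\}$ is unisolvent for $\mathbb{P}_d$ if $p \in \mathbb{P}_d$ and $\int_{K_i} p(x)\,dx = 0$ for $i=1,\dots,N$ imply $p = 0$. Given a unisolvent collection, the Lagrange basis $\{\ell_{K_1},\dots,\ell_{K_N}\}$ of $\mathbb{P}_d(\Omega)$ is the unique basis with $\int_{K_i} \ell_{K_j}(x)\,dx = \delta_{i,j}$. The interpolator $\Pi : C^0(\Omega) \to \mathbb{P}_d(\Omega)$ is $$\Pi f(x) = \sum_{i=1}^N \left(\int_{K_i} f(y)\,dy\right) \ell_{K_i}(x).$$ Set $\Vert f \Vert_\infty := \sup_{x\in\Omega} |f(x)|$ and $\Vert \Pi \Vert_{\mathrm{op}} := \sup_{f \in C^0(\Omega),\, \Vert f\Vert_\infty = 1} \Vert \Pi f\Vert_\infty$.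 The Lebesgue constant is $$\Lambda_d := \sup_{K \subset \Omega} \frac{1}{\mu(K)} \sum_{i=1}^N \mu(K_i) \left| \int_K \ell_{K_i}(x)\,dx \right| = \sup_{\xi \in \Omega} \sum_{i=1}^N \mu(K_i)\, |\ell_{K_i}(\xi)|,$$ where $K$ ranges over compact sets contained in $\Omega$ that are closures of open connected sets $U$ with $0 < \mu(K) = \mu(U) < +\infty$. *)

theory Defs
  imports "HOL-Analysis.Analysis" "HOL-Library.Function_Algebras"
begin

text \<open>
  Real-valued functions on a type form a real vector space under pointwise operations.
  The interpretation provides \<open>rfun.span\<close>, \<open>rfun.independent\<close> and \<open>rfun.dim\<close>.
\<close>

global_interpretation rfun: vector_space "\<lambda>(c::real) (f::'a \<Rightarrow> real) x. c * f x"
  defines rfun_span = "rfun.span" and rfun_dependent = "rfun.dependent" and rfun_dim = "rfun.dim"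
  by unfold_locales (auto simp: fun_eq_iff algebra_simps)

definition monomial :: "('n::finite \<Rightarrow> nat) \<Rightarrow> real ^ 'n \<Rightarrow> real" where
  "monomial \<alpha> x = (\<Prod>i\<in>UNIV. (x $ i) ^ \<alpha> i)"

text \<open>
  Polynomials are polynomial functions on the whole space; restriction to a nonempty open set
  is injective on them, so this set also stands for the restrictions to a domain.
\<close>

definition poly_space :: "nat \<Rightarrow> (real ^ 'n::finite \<Rightarrow> real) set" where
  "poly_space d = rfun.span {monomial \<alpha> | \<alpha>. (\<Sum>i\<in>UNIV. \<alpha> i) \<le> d}"

definition regular_compact :: "(real ^ 'n::finite) set \<Rightarrow> bool" where
  "regular_compact K \<longleftrightarrow> compact K \<and>
     (\<exists>U. open U \<and> connected U \<and> K = closure U \<and>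
          0 < emeasure lebesgue K \<and> emeasure lebesgue K = emeasure lebesgue U \<and>
          emeasure lebesgue K < \<infinity>)"

definition unisolvent :: "nat \<Rightarrow> nat \<Rightarrow> (nat \<Rightarrow> (real ^ 'n::finite) set) \<Rightarrow> bool" where
  "unisolvent d N K \<longleftrightarrow>
     (\<forall>p\<in>poly_space d. (\<forall>i\<in>{1..N}. (LINT x:K i|lebesgue. p x) = 0) \<longrightarrow> p = 0)"

definition is_lagrange_basis ::
    "nat \<Rightarrow> nat \<Rightarrow> (nat \<Rightarrow> (real ^ 'n::finite) set) \<Rightarrow> (nat \<Rightarrow> real ^ 'n \<Rightarrow> real) \<Rightarrow> bool" where
  "is_lagrange_basis d N K l \<longleftrightarrow>
     inj_on l {1..N} \<and> rfun.independent (l ` {1..N}) \<and> rfun.span (l ` {1..N}) = poly_space d \<and>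
     (\<forall>i\<in>{1..N}. \<forall>j\<in>{1..N}. (LINT x:K i|lebesgue. l j x) = (if i = j then 1 else 0))"

text \<open>
  Extensionality fixes the values at indices outside \<open>{1..N}\<close>, so that the
  family is unique as a function on the natural numbers.
\<close>

definition lagrange_basis ::
    "nat \<Rightarrow> nat \<Rightarrow> (nat \<Rightarrow> (real ^ 'n::finite) set) \<Rightarrow> nat \<Rightarrow> real ^ 'n \<Rightarrow> real" where
  "lagrange_basis d N K = (THE l. l \<in> extensional {1..N} \<and> is_lagrange_basis d N K l)"

definition interpolator ::
    "nat \<Rightarrow> nat \<Rightarrow> (nat \<Rightarrow> (real ^ 'n::finite) set) \<Rightarrow> (real ^ 'n \<Rightarrow> real) \<Rightarrow> real ^ 'n \<Rightarrow> real" where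
  "interpolator d N K f x = (\<Sum>i=1..N. (LINT y:K i|lebesgue. f y) * lagrange_basis d N K i x)"

text \<open>
  Suprema are taken in the extended reals: the domain may be unbounded, in which case
  nonconstant polynomials have infinite sup norm.
\<close>

definition sup_norm :: "'a set \<Rightarrow> ('a \<Rightarrow> real) \<Rightarrow> ereal" where
  "sup_norm \<Omega> f = (SUP x\<in>\<Omega>. ereal \<bar>f x\<bar>)"

definition interpolator_op_norm ::
    "(real ^ 'n::finite) set \<Rightarrow> nat \<Rightarrow> nat \<Rightarrow> (nat \<Rightarrow> (real ^ 'n) set) \<Rightarrow> ereal" where
  "interpolator_op_norm \<Omega> d N K =
     (SUP f\<in>{f. continuous_on \<Omega> f \<and> sup_norm \<Omega> f = 1}. sup_norm \<Omega> (interpolator d N K f))"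

definition lebesgue_constant ::
    "(real ^ 'n::finite) set \<Rightarrow> nat \<Rightarrow> nat \<Rightarrow> (nat \<Rightarrow> (real ^ 'n) set) \<Rightarrow> ereal" where
  "lebesgue_constant \<Omega> d N K =
     (SUP S\<in>{S. regular_compact S \<and> S \<subseteq> \<Omega>}.
        ereal (1 / measure lebesgue S *
          (\<Sum>i=1..N. measure lebesgue (K i) * \<bar>LINT x:S|lebesgue. lagrange_basis d N K i x\<bar>)))"

end

theory Submission
  imports Defs
begin

text \<open>
  Both quantities equal the supremum over \<open>\<xi> \<in> \<Omega>\<close> of
  \<open>W \<xi> = (\<Sum>i. \<mu> (K i) * \<bar>l i \<xi>\<bar>)\<close>, where \<open>l\<close> is the Lagrange basis.
  For the operator norm, \<open>W\<close> is an upper bound because \<open>\<bar>\<integral> f\<bar> \<le> \<mu> (K i)\<close> over \<open>K i\<close>; it is attained since the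
  sets are disjoint, so Tietze's theorem extends the constant signs of \<open>l i \<xi>\<close> on \<open>K i\<close> to a
  continuous function of norm one. For the Lebesgue constant, the averages over a compact set are at
  most the maximum of \<open>W\<close> there, and averages over small balls around \<open>\<xi>\<close> come close to \<open>W \<xi>\<close>.
\<close>

section \<open>Polynomial spaces: finite dimension, continuity, integrability\<close>

lemma finite_bounded_exponents: "finite {\<alpha> :: 'n::finite \<Rightarrow> nat. (\<Sum>i\<in>UNIV. \<alpha> i) \<le> d}"
proof (rule finite_subset)
  show "{\<alpha> :: 'n \<Rightarrow> nat. (\<Sum>i\<in>UNIV. \<alpha> i) \<le> d} \<subseteq> PiE UNIV (\<lambda>_. {..d})"
  proof (clarsimp simp: PiE_iff)
    fix \<alpha> :: "'n \<Rightarrow> nat" and i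
    assume "sum \<alpha> UNIV \<le> d"
    moreover have "\<alpha> i \<le> sum \<alpha> UNIV" by (rule member_le_sum) auto
    ultimately show "\<alpha> i \<le> d" by simp
  qed
  show "finite (PiE (UNIV :: 'n set) (\<lambda>_. {..d}))" by (rule finite_PiE) auto
qed

lemma one_in_poly_space: "(\<lambda>x :: real ^ 'n::finite. 1) \<in> poly_space d"
proof -
  have "monomial (\<lambda>_. 0) = (\<lambda>x :: real ^ 'n. 1)"
    by (simp add: fun_eq_iff monomial_def)
  then show ?thesis
    unfolding poly_space_def by (intro rfun.span_base) (auto intro!: exI[of _ "\<lambda>_. 0"])
qed

lemma poly_space_scale: "p \<in> poly_space d \<Longrightarrow> (\<lambda>x. c * p x) \<in> poly_space d"
  unfolding poly_space_def by (rule rfun.span_scale)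

lemma poly_space_sum: "(\<And>i. i \<in> I \<Longrightarrow> p i \<in> poly_space d) \<Longrightarrow> sum p I \<in> poly_space d"
  unfolding poly_space_def by (rule rfun.span_sum)

lemma poly_space_diff: "p \<in> poly_space d \<Longrightarrow> q \<in> poly_space d \<Longrightarrow> p - q \<in> poly_space d"
  unfolding poly_space_def by (rule rfun.span_diff)

lemma sum_fun_apply: "(sum f A) x = (\<Sum>i\<in>A. f i x)"
  by (induction A rule: infinite_finite_induct) auto

lemma poly_space_continuous:
  assumes "p \<in> poly_space d"
  shows "continuous_on A p"
  using assms unfolding poly_space_def
proof (induction rule: rfun.span_induct_alt)
  case base
  show ?case by (simp add: zero_fun_def)
next
  case (step c x y)
  then show ?case
    by (auto simp: plus_fun_def monomial_def[abs_def] intro!: continuous_intros)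
qed

text \<open>Independent sets in the span of a finite set are finite, and only finitely many
  monomials have degree at most \<open>d\<close>. Finiteness of \<open>B\<close> matters because
  \<open>card\<close> of an infinite basis would be 0, leaving \<open>rfun.dim\<close> without its
  usual meaning.\<close>

lemma poly_space_basis:
  obtains B :: "(real ^ 'n::finite \<Rightarrow> real) set"
  where "B \<subseteq> poly_space d" "\<not> rfun.dependent B" "poly_space d = rfun.span B" "finite B"
    "card B = rfun.dim (poly_space d :: (real ^ 'n \<Rightarrow> real) set)"
proof -
  let ?M = "{monomial \<alpha> | \<alpha>. (\<Sum>i\<in>UNIV. \<alpha> i) \<le> d} :: (real ^ 'n \<Rightarrow> real) set"
  obtain B :: "(real ^ 'n \<Rightarrow> real) set"
    where B: "B \<subseteq> poly_space d" "\<not> rfun.dependent B" "poly_space d \<subseteq> rfun.span B"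
      "card B = rfun.dim (poly_space d :: (real ^ 'n \<Rightarrow> real) set)"
    using rfun.basis_exists by blast
  have "finite ?M" by (simp add: setcompr_eq_image finite_bounded_exponents)
  then have "finite B"
    using rfun.independent_span_bound[of ?M B] B(1,2) by (auto simp: poly_space_def)
  moreover have "rfun.span B \<subseteq> poly_space d"
    using B(1) unfolding poly_space_def by (rule rfun.span_minimal) (rule rfun.subspace_span)
  ultimately show ?thesis using B that by blast
qed

lemma set_integrable_continuous_compact:
  fixes f :: "real ^ 'n::finite \<Rightarrow> real"
  assumes "compact S" "continuous_on S f"
  shows "set_integrable lebesgue S f"
proof -
  have "integrable lborel (\<lambda>x. indicator S x *\<^sub>R f x)"
    using assms by (rule borel_integrable_compact)
  then show ?thesis
    unfolding set_integrable_def by (subst integrable_completion) auto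
qed

section \<open>Linear algebra: families dual to separating functionals\<close>

text \<open>Steinitz: a vector of the span of \<open>E\<close> outside the span of \<open>V\<close>
  could be adjoined to \<open>V\<close>, giving an independent set with more than
  \<open>card E\<close> elements inside the span of \<open>E\<close>.\<close>

lemma span_subset_of_card_le:
  assumes "\<not> rfun.dependent V" "V \<subseteq> rfun.span E" "finite E" "card E \<le> card V"
  shows "rfun.span E \<subseteq> rfun.span V"
proof (rule ccontr)
  assume "\<not> rfun.span E \<subseteq> rfun.span V"
  then obtain e where e: "e \<in> rfun.span E" "e \<notin> rfun.span V" by blast
  then have "\<not> rfun.dependent (insert e V)"
    using assms(1) by (simp add: rfun.independent_insertI)
  then have "finite (insert e V) \<and> card (insert e V) \<le> card E"
    using assms(2,3) e(1) by (intro rfun.independent_span_bound) auto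
  moreover have "e \<notin> V" using e(2) rfun.span_base by blast
  ultimately show False using assms(4) by (auto simp: card_insert_if)
qed

lemma rfun_span_finite:
  assumes "finite B"
  shows "rfun.span B = range (\<lambda>u x. \<Sum>b\<in>B. u b * b x)"
  by (simp add: rfun.span_finite[OF assms] fun_eq_iff sum_fun_apply[abs_def])

text \<open>The functions vanishing off \<open>I\<close> model the coordinate space R^I, with the
  delta functions as its unit vectors.\<close>

lemma finitely_supported_in_span_delta:
  assumes "finite I" "\<And>i. i \<notin> I \<Longrightarrow> f i = 0"
  shows "f \<in> rfun.span ((\<lambda>i j. of_bool (j = i)) ` I)"
proof -
  have "f = (\<Sum>i\<in>I. (\<lambda>j. f i * of_bool (j = i)))"
  proof
    fix j
    show "f j = (\<Sum>i\<in>I. (\<lambda>j. f i * of_bool (j = i))) j"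
      using assms by (cases "j \<in> I") (simp_all add: sum_fun_apply sum_mult_of_bool_eq)
  qed
  moreover have "(\<Sum>i\<in>I. (\<lambda>j. f i * of_bool (j = i))) \<in> rfun.span ((\<lambda>i j. of_bool (j = i)) ` I)"
    by (intro rfun.span_sum rfun.span_scale rfun.span_base) auto
  ultimately show ?thesis by simp
qed

text \<open>The map sending p to the vector of all \<open>\<phi> i p\<close> is linear on the span
  of \<open>B\<close> and injective by \<open>sep\<close>. Since \<open>card B = card I\<close>, it
  is onto R^I, and preimages of the unit vectors form the dual family.\<close>

lemma dual_family_exists:
  fixes \<phi> :: "'i \<Rightarrow> ('a \<Rightarrow> real) \<Rightarrow> real"
  assumes "finite I" "finite B" "\<not> rfun.dependent B" "card B = card I"
    and lin: "\<And>i u. i \<in> I \<Longrightarrow> \<phi> i (\<lambda>x. \<Sum>b\<in>B. u b * b x) = (\<Sum>b\<in>B. u b * \<phi> i b)"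
    and sep: "\<And>p. p \<in> rfun.span B \<Longrightarrow> (\<And>i. i \<in> I \<Longrightarrow> \<phi> i p = 0) \<Longrightarrow> p = 0"
  obtains l where "\<And>j. j \<in> I \<Longrightarrow> l j \<in> rfun.span B"
    "\<And>i j. i \<in> I \<Longrightarrow> j \<in> I \<Longrightarrow> \<phi> i (l j) = of_bool (i = j)"
proof -
  \<comment> \<open>\<open>v b\<close> is the image of \<open>b\<close> in R^I, padded by zero off
    \<open>I\<close>; \<open>E\<close> holds the unit vectors.\<close>
  define v where "v b = (\<lambda>i. if i \<in> I then \<phi> i b else 0)" for b
  define E where "E = (\<lambda>i j. of_bool (j = i) :: real) ` I"
  \<comment> \<open>Injectivity on coefficients: a vanishing combination of the images belongs to a
    p killed by all functionals, so p = 0 by \<open>sep\<close> and independence of \<open>B\<close>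
    applies. The sum runs over \<open>B\<close>, not over the image of \<open>v\<close>, so that it
    can be used to prove \<open>v\<close> injective.\<close>
  have comb: "w = (\<lambda>_. 0)" if "(\<Sum>b\<in>B. (\<lambda>i. w b * v b i)) = 0" "\<And>b. b \<notin> B \<Longrightarrow> w b = 0" for w
  proof -
    let ?p = "\<lambda>x. \<Sum>b\<in>B. w b * b x"
    have "\<phi> i ?p = 0" if "i \<in> I" for i
      using \<open>(\<Sum>b\<in>B. (\<lambda>i. w b * v b i)) = 0\<close>[THEN fun_cong, of i] that
      by (simp add: lin sum_fun_apply v_def)
    then have "?p = 0"
      by (intro sep) (auto simp: rfun_span_finite assms(2))
    then have "(\<Sum>b\<in>B. (\<lambda>x. w b * b x)) = 0"
      by (simp add: fun_eq_iff sum_fun_apply)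
    then have "w b = 0" if "b \<in> B" for b
      using rfun.independentD[OF assms(3,2) subset_refl _ that] by blast
    with that(2) show ?thesis by blast
  qed
  have inj: "inj_on v B"
  proof (rule inj_onI, rule ccontr)
    fix a b assume ab: "a \<in> B" "b \<in> B" "v a = v b" "a \<noteq> b"
    \<comment> \<open>This combination sums to \<open>v a - v b\<close>, which is 0, while its
      coefficient at \<open>a\<close> is 1.\<close>
    let ?w = "\<lambda>c. of_bool (c = a) - of_bool (c = b) :: real"
    have delta: "(\<Sum>c\<in>B. of_bool (c = e) * v c i) = v e i" if "e \<in> B" for e i
    proof -
      have "B \<inter> {c. c = e} = {e}" using that by blast
      then show ?thesis using assms(2) by (simp only: sum_of_bool_mult_eq) simp
    qed
    have "?w = (\<lambda>_. 0)"
    proof (rule comb)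
      show "(\<Sum>c\<in>B. (\<lambda>i. ?w c * v c i)) = 0"
      proof
        fix i
        show "(\<Sum>c\<in>B. (\<lambda>i. ?w c * v c i)) i = 0 i"
          using ab(1,2)
          by (simp only: sum_fun_apply left_diff_distrib sum_subtractf delta ab(3)) simp
      qed
      show "?w c = 0" if "c \<notin> B" for c using that ab(1,2) by auto
    qed
    from fun_cong[OF this, of a] show False using ab(4) by simp
  qed
  have "\<not> rfun.dependent (v ` B)"
  proof
    assume "rfun.dependent (v ` B)"
    then obtain u where u: "\<exists>w\<in>v ` B. u w \<noteq> 0" "(\<Sum>w\<in>v ` B. (\<lambda>i. u w * w i)) = 0"
      using assms(2) by (auto simp: rfun.dependent_finite)
    have "(\<lambda>b. if b \<in> B then u (v b) else 0) = (\<lambda>_. 0)"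
      using u(2) by (intro comb) (simp_all add: sum.reindex[OF inj] cong: sum.cong)
    with u(1) show False by (auto simp: fun_eq_iff split: if_splits)
  qed
  moreover have "v ` B \<subseteq> rfun.span E"
    unfolding E_def using assms(1) by (auto intro!: finitely_supported_in_span_delta simp: v_def)
  moreover have "card E \<le> card (v ` B)"
    using card_image_le[OF assms(1)] by (simp add: E_def card_image[OF inj] assms(4))
  ultimately have "rfun.span E \<subseteq> rfun.span (v ` B)"
    using assms(1) by (intro span_subset_of_card_le) (auto simp: E_def)
  have "\<exists>p\<in>rfun.span B. \<forall>i\<in>I. \<phi> i p = of_bool (i = j)" if "j \<in> I" for j
  proof -
    have "(\<lambda>i. of_bool (i = j)) \<in> rfun.span E"
      using that by (intro rfun.span_base) (auto simp: E_def)
    then have "(\<lambda>i. of_bool (i = j)) \<in> rfun.span (v ` B)"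
      using \<open>rfun.span E \<subseteq> rfun.span (v ` B)\<close> by blast
    then obtain u where u: "(\<lambda>i. of_bool (i = j)) = (\<lambda>i. \<Sum>w\<in>v ` B. u w * w i)"
      using assms(2) by (auto simp: rfun_span_finite)
    \<comment> \<open>The coefficients expressing the unit vector through the images, put on
      \<open>B\<close> itself, give its preimage.\<close>
    let ?p = "\<lambda>x. \<Sum>b\<in>B. u (v b) * b x"
    have "\<phi> i ?p = of_bool (i = j)" if "i \<in> I" for i
    proof -
      have "v b i = \<phi> i b" for b using that by (simp add: v_def)
      then show ?thesis
        using that fun_cong[OF u, of i] by (simp add: lin sum.reindex[OF inj])
    qed
    moreover have "?p \<in> rfun.span B"
      using assms(2) by (auto simp: rfun_span_finite)
    ultimately show ?thesis by blast
  qed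
  then show ?thesis using that by metis
qed

section \<open>Existence and uniqueness of the Lagrange basis\<close>

lemma set_integral_linear_combination:
  fixes f :: "'i \<Rightarrow> 'a \<Rightarrow> real"
  assumes "\<And>j. j \<in> J \<Longrightarrow> set_integrable M A (f j)"
  shows "(LINT x:A|M. (\<Sum>j\<in>J. c j * f j x)) = (\<Sum>j\<in>J. c j * (LINT x:A|M. f j x))"
proof -
  have "(LINT x:A|M. (\<Sum>j\<in>J. c j * f j x)) = (\<Sum>j\<in>J. (LINT x|M. c j * (indicator A x *\<^sub>R f j x)))"
    unfolding set_lebesgue_integral_def using assms
    by (subst Bochner_Integration.integral_sum[symmetric])
      (auto simp: set_integrable_def sum_distrib_left algebra_simps)
  then show ?thesis by (simp add: set_lebesgue_integral_def)
qed

text \<open>Duality makes integration over \<open>K i\<close> read off the i-th coefficient of a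
  combination, whence independence. Unisolvence makes every polynomial equal to its own interpolant,
  whence the span.\<close>

lemma is_lagrange_basisI:
  assumes uni: "unisolvent d N K" and compact: "\<And>i. i \<in> {1..N} \<Longrightarrow> compact (K i)"
    and l: "\<And>i. i \<in> {1..N} \<Longrightarrow> l i \<in> poly_space d"
    and dual: "\<And>i j. i \<in> {1..N} \<Longrightarrow> j \<in> {1..N} \<Longrightarrow>
      (LINT x:K i|lebesgue. l j x) = of_bool (i = j)"
  shows "is_lagrange_basis d N K l"
proof -
  have int: "set_integrable lebesgue (K i) p" if "i \<in> {1..N}" "p \<in> poly_space d" for i p
    using that compact by (intro set_integrable_continuous_compact poly_space_continuous)
  have comb: "(LINT x:K i|lebesgue. (\<Sum>j\<in>{1..N}. c j * l j x)) = c i" if "i \<in> {1..N}" for i c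
  proof -
    have "(LINT x:K i|lebesgue. (\<Sum>j\<in>{1..N}. c j * l j x)) =
        (\<Sum>j\<in>{1..N}. c j * (LINT x:K i|lebesgue. l j x))"
      using that by (intro set_integral_linear_combination int l)
    also have "\<dots> = (\<Sum>j\<in>{1..N}. if i = j then c j else 0)"
      using that by (intro sum.cong) (auto simp: dual)
    finally show ?thesis using that by simp
  qed
  have inj: "inj_on l {1..N}"
  proof (rule inj_onI)
    fix i j assume "i \<in> {1..N}" "j \<in> {1..N}" "l i = l j"
    then show "i = j" using dual[of i i] dual[of i j] by (auto split: if_splits)
  qed
  have "\<not> rfun.dependent (l ` {1..N})"
  proof
    assume "rfun.dependent (l ` {1..N})"
    then obtain u where u: "\<exists>w\<in>l ` {1..N}. u w \<noteq> 0" "(\<Sum>w\<in>l ` {1..N}. (\<lambda>x. u w * w x)) = 0"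
      by (auto simp: rfun.dependent_finite)
    have "(\<Sum>j\<in>{1..N}. u (l j) * l j x) = 0" for x
      using fun_cong[OF u(2), of x] by (simp add: sum.reindex[OF inj] sum_fun_apply del: One_nat_def)
    then have "u (l i) = 0" if "i \<in> {1..N}" for i
      using comb[OF that, of "\<lambda>j. u (l j)"] by simp
    with u(1) show False by blast
  qed
  moreover have "rfun.span (l ` {1..N}) = poly_space d"
  proof
    show "rfun.span (l ` {1..N}) \<subseteq> poly_space d"
      unfolding poly_space_def
      by (intro rfun.span_minimal rfun.subspace_span) (auto simp: l[unfolded poly_space_def])
    show "poly_space d \<subseteq> rfun.span (l ` {1..N})"
    proof
      fix p :: "real ^ 'a \<Rightarrow> real" assume p: "p \<in> poly_space d"
      define c where "c i = (LINT x:K i|lebesgue. p x)" for i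
      \<comment> \<open>The interpolant of \<open>p\<close>: it has the same integrals over all
        \<open>K i\<close>, so \<open>p - q\<close> falls under unisolvence.\<close>
      define q where "q = (\<Sum>i\<in>{1..N}. (\<lambda>x. c i * l i x))"
      have q: "q \<in> poly_space d"
        unfolding q_def by (intro poly_space_sum poly_space_scale l)
      have "(LINT x:K i|lebesgue. (p - q) x) = 0" if "i \<in> {1..N}" for i
      proof -
        have "(LINT x:K i|lebesgue. q x) = c i"
          using comb[OF that, of c] by (simp add: q_def sum_fun_apply)
        moreover have "(LINT x:K i|lebesgue. (p - q) x) = c i - (LINT x:K i|lebesgue. q x)"
          using set_integral_diff(2)[OF int[OF that p] int[OF that q]] by (simp add: c_def)
        ultimately show ?thesis by simp
      qed
      then have "p - q = 0"
        using uni poly_space_diff[OF p q] unfolding unisolvent_def by blast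
      moreover have "q \<in> rfun.span (l ` {1..N})"
        unfolding q_def by (intro rfun.span_sum rfun.span_scale rfun.span_base) auto
      ultimately show "p \<in> rfun.span (l ` {1..N})" by simp
    qed
  qed
  ultimately show ?thesis
    using inj dual unfolding is_lagrange_basis_def by (auto simp: rfun_dependent_def)
qed

lemma is_lagrange_basis_poly:
  "is_lagrange_basis d N K l \<Longrightarrow> i \<in> {1..N} \<Longrightarrow> l i \<in> poly_space d"
  using rfun.span_base[of "l i" "l ` {1..N}"] unfolding is_lagrange_basis_def by auto

text \<open>The two candidates have equal integrals over every \<open>K i\<close>, so unisolvence
  kills their difference.\<close>

lemma is_lagrange_basis_unique:
  assumes uni: "unisolvent d N K" and compact: "\<And>i. i \<in> {1..N} \<Longrightarrow> compact (K i)"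
    and l: "is_lagrange_basis d N K l" and m: "is_lagrange_basis d N K m" and j: "j \<in> {1..N}"
  shows "l j = m j"
proof -
  have "(LINT x:K i|lebesgue. (l j - m j) x) = 0" if i: "i \<in> {1..N}" for i
  proof -
    have "set_integrable lebesgue (K i) (l j)" "set_integrable lebesgue (K i) (m j)"
      using is_lagrange_basis_poly[OF l j] is_lagrange_basis_poly[OF m j] compact[OF i]
      by (auto intro!: set_integrable_continuous_compact poly_space_continuous)
    from set_integral_diff(2)[OF this] show ?thesis
      using l m i j by (simp add: is_lagrange_basis_def)
  qed
  moreover have "l j - m j \<in> poly_space d"
    using is_lagrange_basis_poly[OF l j] is_lagrange_basis_poly[OF m j] by (rule poly_space_diff)
  ultimately have "l j - m j = 0"
    using uni unfolding unisolvent_def by blast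
  then show ?thesis by simp
qed

text \<open>Justifies the definite description. Existence is the dual family of the integration
  functionals: unisolvence separates polynomials, and \<open>N\<close> being the dimension matches
  the number of functionals to that of basis elements.\<close>

lemma is_lagrange_basis_lagrange_basis:
  fixes K :: "nat \<Rightarrow> (real ^ 'n::finite) set"
  assumes N: "N = rfun.dim (poly_space d :: (real ^ 'n \<Rightarrow> real) set)"
    and uni: "unisolvent d N K" and compact: "\<And>i. i \<in> {1..N} \<Longrightarrow> compact (K i)"
  shows "is_lagrange_basis d N K (lagrange_basis d N K)"
proof -
  obtain B :: "(real ^ 'n \<Rightarrow> real) set"
    where B: "B \<subseteq> poly_space d" "\<not> rfun.dependent B" "poly_space d = rfun.span B" "finite B"
      "card B = N"
    using poly_space_basis N by metis
  obtain l where "\<And>j. j \<in> {1..N} \<Longrightarrow> l j \<in> poly_space d"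
    "\<And>i j. i \<in> {1..N} \<Longrightarrow> j \<in> {1..N} \<Longrightarrow> (LINT x:K i|lebesgue. l j x) = of_bool (i = j)"
  proof (rule dual_family_exists[of "{1..N}" B "\<lambda>i p. LINT x:K i|lebesgue. p x"])
    show "(LINT x:K i|lebesgue. (\<Sum>b\<in>B. u b * b x)) = (\<Sum>b\<in>B. u b * (LINT x:K i|lebesgue. b x))"
      if "i \<in> {1..N}" for i u
      using B(1) compact[OF that]
      by (intro set_integral_linear_combination set_integrable_continuous_compact)
        (auto intro: poly_space_continuous)
    show "p = 0" if "p \<in> rfun.span B" "\<And>i. i \<in> {1..N} \<Longrightarrow> (LINT x:K i|lebesgue. p x) = 0" for p
      using that uni B(3) unfolding unisolvent_def by blast
  qed (use B in auto)
  \<comment> \<open>Restricting gives the extensional representative on which uniqueness as a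
    function depends.\<close>
  then have "is_lagrange_basis d N K (restrict l {1..N})"
    by (intro is_lagrange_basisI uni compact) auto
  then have "\<exists>!l. l \<in> extensional {1..N} \<and> is_lagrange_basis d N K l"
  proof (intro ex1I[of _ "restrict l {1..N}"] conjI)
    fix m assume "is_lagrange_basis d N K (restrict l {1..N})"
      and m: "m \<in> extensional {1..N} \<and> is_lagrange_basis d N K m"
    then show "m = restrict l {1..N}"
      using is_lagrange_basis_unique[OF uni compact] by (intro extensionalityI[of _ "{1..N}"]) blast+
  qed auto
  from theI'[OF this] show ?thesis
    unfolding lagrange_basis_def by blast
qed

section \<open>Averages over regular compact sets\<close>

lemma regular_compactD:
  assumes "regular_compact S"
  shows "compact S" "measure lebesgue S > 0" "S \<noteq> {}"
proof -
  have pos: "0 < emeasure lebesgue S" "emeasure lebesgue S < \<infinity>" and "compact S"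
    using assms unfolding regular_compact_def by auto
  then show "compact S" "S \<noteq> {}" by auto
  show "measure lebesgue S > 0"
    using pos by (simp add: measure_def enn2real_positive_iff)
qed

text \<open>Admits small balls in the supremum defining \<open>lebesgue_constant\<close>.\<close>

lemma regular_compact_cball:
  assumes "r > 0"
  shows "regular_compact (cball x r :: (real ^ 'n::finite) set)"
  unfolding regular_compact_def
proof (intro conjI exI[of _ "ball x r"])
  show "emeasure lebesgue (cball x r) = emeasure lebesgue (ball x r)"
    using assms by (simp add: emeasure_cball emeasure_ball)
  show "0 < emeasure lebesgue (cball x r)"
    using assms by (simp add: emeasure_cball unit_ball_vol_pos ennreal_zero_less_mult_iff)
  show "emeasure lebesgue (cball x r) < \<infinity>"
    using assms by (simp add: emeasure_cball)
qed (use assms in auto)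

lemma set_integral_const_compact:
  fixes S :: "(real ^ 'n::finite) set" and c :: real
  assumes "compact S"
  shows "(LINT x:S|lebesgue. c) = c * measure lebesgue S"
  using lmeasurable_compact[OF assms]
  by (subst set_integral_const) (auto simp: fmeasurable_def)

lemma abs_set_integral_le:
  fixes f :: "real ^ 'n::finite \<Rightarrow> real"
  assumes "compact S" "continuous_on S f"
  shows "\<bar>LINT x:S|lebesgue. f x\<bar> \<le> (LINT x:S|lebesgue. \<bar>f x\<bar>)"
  using set_integral_norm_bound[OF set_integrable_continuous_compact[OF assms]] by simp

text \<open>Moving the absolute values inside the integrals leaves the average of the continuous
  function \<open>?W\<close>, which is at most its maximum, attained at \<xi> by
  compactness.\<close>

lemma weighted_average_le_pointwise:
  fixes l :: "'i \<Rightarrow> real ^ 'n::finite \<Rightarrow> real"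
  assumes S: "regular_compact S" and l: "\<And>i. i \<in> I \<Longrightarrow> continuous_on S (l i)"
    and w: "\<And>i. i \<in> I \<Longrightarrow> 0 \<le> w i"
  obtains \<xi> where "\<xi> \<in> S"
    "1 / measure lebesgue S * (\<Sum>i\<in>I. w i * \<bar>LINT x:S|lebesgue. l i x\<bar>) \<le> (\<Sum>i\<in>I. w i * \<bar>l i \<xi>\<bar>)"
proof -
  note S = regular_compactD[OF S]
  let ?W = "\<lambda>x. \<Sum>i\<in>I. w i * \<bar>l i x\<bar>"
  have W: "continuous_on S ?W" by (intro continuous_intros l)
  then obtain \<xi> where \<xi>: "\<xi> \<in> S" "\<And>y. y \<in> S \<Longrightarrow> ?W y \<le> ?W \<xi>"
    using continuous_attains_sup[OF S(1,3)] by blast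
  have "(\<Sum>i\<in>I. w i * \<bar>LINT x:S|lebesgue. l i x\<bar>) \<le> (\<Sum>i\<in>I. w i * (LINT x:S|lebesgue. \<bar>l i x\<bar>))"
    using S(1) l w by (intro sum_mono mult_left_mono abs_set_integral_le) auto
  also have "\<dots> = (LINT x:S|lebesgue. ?W x)"
    using S(1) l by (intro set_integral_linear_combination[symmetric]
        set_integrable_continuous_compact continuous_intros) auto
  also have "\<dots> \<le> (LINT x:S|lebesgue. ?W \<xi>)"
    using S(1) W \<xi>(2) by (intro set_integral_mono set_integrable_continuous_compact) auto
  also have "\<dots> = ?W \<xi> * measure lebesgue S"
    using S(1) by (rule set_integral_const_compact)
  finally have "1 / measure lebesgue S * (\<Sum>i\<in>I. w i * \<bar>LINT x:S|lebesgue. l i x\<bar>) \<le> ?W \<xi>"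
    using S(2) by (simp add: field_simps)
  with \<xi>(1) show ?thesis by (rule that)
qed

text \<open>Taking absolute values inside the integral would give the wrong direction. Instead the
  signs of the \<open>l i\<close> are frozen at \<xi>: the resulting \<open>?V\<close> is linear in
  the \<open>l i\<close>, so its integral is a signed sum of theirs, and by continuity it stays near
  its value at \<xi>.\<close>

lemma pointwise_le_weighted_average:
  fixes l :: "'i \<Rightarrow> real ^ 'n::finite \<Rightarrow> real"
  assumes \<Omega>: "open \<Omega>" "\<xi> \<in> \<Omega>" and l: "\<And>i. i \<in> I \<Longrightarrow> continuous_on \<Omega> (l i)"
    and w: "\<And>i. i \<in> I \<Longrightarrow> 0 \<le> w i" and "e > 0"
  obtains S where "regular_compact S" "S \<subseteq> \<Omega>"
    "(\<Sum>i\<in>I. w i * \<bar>l i \<xi>\<bar>) - e \<le> 1 / measure lebesgue S * (\<Sum>i\<in>I. w i * \<bar>LINT x:S|lebesgue. l i x\<bar>)"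
proof -
  let ?V = "\<lambda>x. \<Sum>i\<in>I. (w i * sgn (l i \<xi>)) * l i x"
  have V\<xi>: "?V \<xi> = (\<Sum>i\<in>I. w i * \<bar>l i \<xi>\<bar>)"
    by (intro sum.cong) (auto simp: abs_sgn)
  have V: "continuous_on \<Omega> ?V" by (intro continuous_intros l)
  then have "isCont ?V \<xi>" using \<Omega> by (simp add: continuous_on_eq_continuous_at)
  then obtain \<delta> where \<delta>: "\<delta> > 0" "\<And>x. dist x \<xi> < \<delta> \<Longrightarrow> dist (?V x) (?V \<xi>) < e"
    using \<open>e > 0\<close> unfolding continuous_at_eps_delta by blast
  obtain \<rho> where \<rho>: "\<rho> > 0" "cball \<xi> \<rho> \<subseteq> \<Omega>" using \<Omega> open_contains_cball by blast
  \<comment> \<open>Halving \<delta> puts the closed ball inside the open ball where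
    \<open>?V\<close> varies by less than \<open>e\<close>; \<rho> keeps it in \<Omega>.\<close>
  define S where "S = cball \<xi> (min (\<delta> / 2) \<rho>)"
  have reg: "regular_compact S" unfolding S_def using \<delta>(1) \<rho>(1) by (intro regular_compact_cball) simp
  note S = regular_compactD[OF reg]
  have sub: "S \<subseteq> \<Omega>" using \<rho>(2) by (auto simp: S_def)
  have near: "?V \<xi> - e \<le> ?V x" if "x \<in> S" for x
    using \<delta>(2)[of x] \<delta>(1) that by (auto simp: S_def dist_commute dist_real_def)
  have "(?V \<xi> - e) * measure lebesgue S = (LINT x:S|lebesgue. ?V \<xi> - e)"
    using set_integral_const_compact[OF S(1)] by simp
  also have "\<dots> \<le> (LINT x:S|lebesgue. ?V x)"
    using S(1) continuous_on_subset[OF V sub] near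
    by (intro set_integral_mono set_integrable_continuous_compact) auto
  also have "\<dots> = (\<Sum>i\<in>I. (w i * sgn (l i \<xi>)) * (LINT x:S|lebesgue. l i x))"
    using S(1) continuous_on_subset[OF l sub]
    by (intro set_integral_linear_combination set_integrable_continuous_compact) auto
  also have "\<dots> \<le> (\<Sum>i\<in>I. w i * \<bar>LINT x:S|lebesgue. l i x\<bar>)"
    unfolding mult.assoc using w by (intro sum_mono mult_left_mono) (auto simp: sgn_real_def)
  finally have "?V \<xi> - e \<le> 1 / measure lebesgue S * (\<Sum>i\<in>I. w i * \<bar>LINT x:S|lebesgue. l i x\<bar>)"
    using S(2) by (simp add: field_simps)
  with reg sub show ?thesis unfolding V\<xi> by (rule that)
qed

section \<open>Continuous test functions with prescribed values\<close>

text \<open>A function constant on each of finitely many disjoint closed sets is continuous on their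
  union, and Tietze extends it without increasing the bound 1.\<close>

lemma continuous_extension_of_constants:
  fixes K :: "'i \<Rightarrow> (real ^ 'n::finite) set" and s :: "'i \<Rightarrow> real"
  assumes "finite I" and K: "\<And>i. i \<in> I \<Longrightarrow> compact (K i)"
    and disj: "\<And>i j. i \<in> I \<Longrightarrow> j \<in> I \<Longrightarrow> i \<noteq> j \<Longrightarrow> K i \<inter> K j = {}"
    and s: "\<And>i. i \<in> I \<Longrightarrow> \<bar>s i\<bar> \<le> 1"
  obtains f where "continuous_on UNIV f" "\<And>x. \<bar>f x\<bar> \<le> 1" "\<And>i x. i \<in> I \<Longrightarrow> x \<in> K i \<Longrightarrow> f x = s i"
proof -
  \<comment> \<open>Disjointness makes the chosen index the only one, so \<open>g\<close> takes the
    value \<open>s i\<close> throughout \<open>K i\<close>.\<close>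
  define g where "g x = s (SOME i. i \<in> I \<and> x \<in> K i)" for x
  have g: "g x = s i" if "i \<in> I" "x \<in> K i" for i x
  proof -
    have "(SOME i. i \<in> I \<and> x \<in> K i) = i"
      using that disj by (intro some_equality) blast+
    then show ?thesis by (simp add: g_def)
  qed
  have cl: "closed (K i)" if "i \<in> I" for i using K that compact_imp_closed by blast
  have "continuous_on (\<Union>i\<in>I. K i) g"
  proof (intro continuous_on_closed_Union \<open>finite I\<close> cl)
    show "continuous_on (K i) g" if "i \<in> I" for i
      by (rule continuous_on_eq[OF continuous_on_const[of _ "s i"]]) (simp add: g[OF that])
  qed
  moreover have "closedin (top_of_set UNIV) (\<Union>i\<in>I. K i)"
    using \<open>finite I\<close> cl by auto
  moreover have "norm (g x) \<le> 1" if "x \<in> (\<Union>i\<in>I. K i)" for x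
    using that g s by auto
  ultimately obtain f where f: "continuous_on UNIV f"
    "\<And>x. x \<in> (\<Union>i\<in>I. K i) \<Longrightarrow> f x = g x" "\<And>x. x \<in> UNIV \<Longrightarrow> norm (f x) \<le> 1"
    using Tietze[of "\<Union>i\<in>I. K i" g UNIV 1] by auto
  show ?thesis
  proof (rule that)
    show "f x = s i" if "i \<in> I" "x \<in> K i" for i x
      using f(2)[of x] g[OF that] that by auto
  qed (use f in auto)
qed

section \<open>Both constants as the same pointwise supremum\<close>

lemma lebesgue_constant_eq_pointwise:
  fixes \<Omega> :: "(real ^ 'n::finite) set"
  assumes "open \<Omega>" and l: "\<And>i. i \<in> {1..N} \<Longrightarrow> continuous_on \<Omega> (lagrange_basis d N K i)"
  shows "lebesgue_constant \<Omega> d N K =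
    (SUP \<xi>\<in>\<Omega>. ereal (\<Sum>i=1..N. measure lebesgue (K i) * \<bar>lagrange_basis d N K i \<xi>\<bar>))"
    (is "_ = (SUP \<xi>\<in>\<Omega>. ereal (?W \<xi>))")
proof (rule antisym)
  show "lebesgue_constant \<Omega> d N K \<le> (SUP \<xi>\<in>\<Omega>. ereal (?W \<xi>))"
    unfolding lebesgue_constant_def
  proof (rule SUP_least)
    fix S assume "S \<in> {S. regular_compact S \<and> S \<subseteq> \<Omega>}"
    then have S: "regular_compact S" "S \<subseteq> \<Omega>" by auto
    obtain \<xi> where "\<xi> \<in> S" "1 / measure lebesgue S * (\<Sum>i\<in>{1..N}. measure lebesgue (K i) *
        \<bar>LINT x:S|lebesgue. lagrange_basis d N K i x\<bar>) \<le> ?W \<xi>"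
      by (rule weighted_average_le_pointwise[OF S(1), of "{1..N}" "lagrange_basis d N K"
            "\<lambda>i. measure lebesgue (K i)"])
        (auto intro: continuous_on_subset[OF l S(2)])
    then show "ereal (1 / measure lebesgue S * (\<Sum>i=1..N. measure lebesgue (K i) *
        \<bar>LINT x:S|lebesgue. lagrange_basis d N K i x\<bar>)) \<le> (SUP \<xi>\<in>\<Omega>. ereal (?W \<xi>))"
      using S(2) by (intro SUP_upper2[of \<xi>]) auto
  qed
  show "(SUP \<xi>\<in>\<Omega>. ereal (?W \<xi>)) \<le> lebesgue_constant \<Omega> d N K"
  proof (rule SUP_least, rule ereal_le_epsilon2)
    \<comment> \<open>Averages over balls only approach \<open>?W \<xi>\<close>, so the bound is
      shown up to an arbitrary positive \<open>e\<close>.\<close>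
    fix \<xi> and e :: real assume \<xi>: "\<xi> \<in> \<Omega>" and e: "0 < e"
    obtain S where S: "regular_compact S" "S \<subseteq> \<Omega>"
      "?W \<xi> - e \<le> 1 / measure lebesgue S * (\<Sum>i\<in>{1..N}. measure lebesgue (K i) *
        \<bar>LINT x:S|lebesgue. lagrange_basis d N K i x\<bar>)"
      by (rule pointwise_le_weighted_average[OF assms(1) \<xi> _ _ e, of "{1..N}" "lagrange_basis d N K"
            "\<lambda>i. measure lebesgue (K i)"]) (auto intro: l)
    have "ereal (?W \<xi> - e) \<le> lebesgue_constant \<Omega> d N K"
      unfolding lebesgue_constant_def using S by (intro SUP_upper2[of S]) simp_all
    then have "ereal (?W \<xi> - e) + ereal e \<le> lebesgue_constant \<Omega> d N K + ereal e"
      by (rule add_right_mono)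
    then show "ereal (?W \<xi>) \<le> lebesgue_constant \<Omega> d N K + ereal e" by simp
  qed
qed

lemma interpolator_op_norm_eq_pointwise:
  fixes \<Omega> :: "(real ^ 'n::finite) set"
  assumes K: "\<And>i. i \<in> {1..N} \<Longrightarrow> regular_compact (K i) \<and> K i \<subseteq> \<Omega>" and "N \<ge> 1"
    and disj: "\<And>i j. i \<in> {1..N} \<Longrightarrow> j \<in> {1..N} \<Longrightarrow> i \<noteq> j \<Longrightarrow> K i \<inter> K j = {}"
  shows "interpolator_op_norm \<Omega> d N K =
    (SUP \<xi>\<in>\<Omega>. ereal (\<Sum>i=1..N. measure lebesgue (K i) * \<bar>lagrange_basis d N K i \<xi>\<bar>))"
    (is "_ = (SUP \<xi>\<in>\<Omega>. ereal (?W \<xi>))")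
proof (rule antisym)
  have K': "compact (K i)" "K i \<noteq> {}" "K i \<subseteq> \<Omega>" if "i \<in> {1..N}" for i
    using K[OF that] regular_compactD by auto
  show "interpolator_op_norm \<Omega> d N K \<le> (SUP \<xi>\<in>\<Omega>. ereal (?W \<xi>))"
    unfolding interpolator_op_norm_def
  proof (rule SUP_least)
    fix f assume "f \<in> {f. continuous_on \<Omega> f \<and> sup_norm \<Omega> f = 1}"
    then have cont: "continuous_on \<Omega> f" and "sup_norm \<Omega> f = 1" by auto
    then have bound: "\<bar>f x\<bar> \<le> 1" if "x \<in> \<Omega>" for x
      using SUP_upper[OF that, of "\<lambda>x. ereal \<bar>f x\<bar>"] by (simp add: sup_norm_def)
    have int: "\<bar>LINT y:K i|lebesgue. f y\<bar> \<le> measure lebesgue (K i)" if i: "i \<in> {1..N}" for i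
    proof -
      have f: "continuous_on (K i) f" using continuous_on_subset[OF cont K'(3)[OF i]] .
      have "\<bar>LINT y:K i|lebesgue. f y\<bar> \<le> (LINT y:K i|lebesgue. \<bar>f y\<bar>)"
        using K'(1)[OF i] f by (rule abs_set_integral_le)
      also have "\<dots> \<le> (LINT y:K i|lebesgue. 1)"
        using K'(1,3)[OF i] f bound
        by (intro set_integral_mono set_integrable_continuous_compact continuous_intros) auto
      also have "\<dots> = measure lebesgue (K i)"
        using set_integral_const_compact[OF K'(1)[OF i], of 1] by simp
      finally show ?thesis .
    qed
    show "sup_norm \<Omega> (interpolator d N K f) \<le> (SUP \<xi>\<in>\<Omega>. ereal (?W \<xi>))"
      unfolding sup_norm_def
    proof (rule SUP_mono', unfold ereal_less_eq)
      fix \<xi>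
      have "\<bar>interpolator d N K f \<xi>\<bar> \<le>
          (\<Sum>i=1..N. \<bar>(LINT y:K i|lebesgue. f y) * lagrange_basis d N K i \<xi>\<bar>)"
        unfolding interpolator_def by (rule sum_abs)
      also have "\<dots> \<le> ?W \<xi>"
        using int by (intro sum_mono) (simp add: abs_mult mult_right_mono)
      finally show "\<bar>interpolator d N K f \<xi>\<bar> \<le> ?W \<xi>" .
    qed
  qed
  show "(SUP \<xi>\<in>\<Omega>. ereal (?W \<xi>)) \<le> interpolator_op_norm \<Omega> d N K"
  proof (rule SUP_least)
    fix \<xi> assume \<xi>: "\<xi> \<in> \<Omega>"
    \<comment> \<open>not \<open>sgn\<close>, which vanishes where the basis function does: the test function needs norm 1\<close>
    define s where "s i = (if lagrange_basis d N K i \<xi> \<ge> 0 then 1 else - 1 :: real)" for i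
    obtain f where f: "continuous_on UNIV f" "\<And>x. \<bar>f x\<bar> \<le> 1"
      "\<And>i x. i \<in> {1..N} \<Longrightarrow> x \<in> K i \<Longrightarrow> f x = s i"
      by (rule continuous_extension_of_constants[of "{1..N}" K s])
        (use K'(1) disj in \<open>auto simp: s_def\<close>)
    have "sup_norm \<Omega> f = 1"
    proof (rule antisym)
      show "sup_norm \<Omega> f \<le> 1" unfolding sup_norm_def using f(2) by (intro SUP_least) simp
      \<comment> \<open>The norm 1 is attained on the nonempty set \<open>K 1\<close>, where
        \<open>f\<close> is constantly 1 or -1; this is where \<open>N \<ge> 1\<close>
        enters.\<close>
      have "1 \<in> {1..N}" using \<open>N \<ge> 1\<close> by simp
      then obtain x where "x \<in> K 1" "x \<in> \<Omega>" "f x = s 1" using K'(2,3)[of 1] f(3)[of 1] by blast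
      then show "1 \<le> sup_norm \<Omega> f"
        unfolding sup_norm_def by (intro SUP_upper2[of x]) (auto simp: s_def)
    qed
    \<comment> \<open>The integral of \<open>f\<close> over \<open>K i\<close> is \<open>s i\<close>
      times the measure of \<open>K i\<close>, and \<open>s i\<close> turns the value of the basis
      function at \<xi> into its absolute value.\<close>
    moreover have "interpolator d N K f \<xi> = ?W \<xi>"
      unfolding interpolator_def
    proof (rule sum.cong[OF refl])
      fix i assume i: "i \<in> {1..N}"
      have "(LINT y:K i|lebesgue. f y) = (LINT y:K i|lebesgue. s i)"
        using lmeasurable_compact[OF K'(1)[OF i]] f(3)[OF i]
        by (intro set_lebesgue_integral_cong) (auto simp: fmeasurable_def)
      then show "(LINT y:K i|lebesgue. f y) * lagrange_basis d N K i \<xi> =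
          measure lebesgue (K i) * \<bar>lagrange_basis d N K i \<xi>\<bar>"
        by (simp add: set_integral_const_compact[OF K'(1)[OF i]] s_def)
    qed
    then have "ereal (?W \<xi>) \<le> sup_norm \<Omega> (interpolator d N K f)"
      unfolding sup_norm_def using \<xi> by (intro SUP_upper2[of \<xi>]) auto
    ultimately show "ereal (?W \<xi>) \<le> interpolator_op_norm \<Omega> d N K"
      unfolding interpolator_op_norm_def using continuous_on_subset[OF f(1) subset_UNIV]
      by (intro SUP_upper2[of f]) simp_all
  qed
qed

theorem theorem2p5:
  fixes \<Omega> :: "(real ^ 'n::finite) set" and K :: "nat \<Rightarrow> (real ^ 'n) set" and d N :: nat
  assumes "open \<Omega>" and "connected \<Omega>" and "\<Omega> \<noteq> {}"
    and "N = rfun.dim (poly_space d :: (real ^ 'n \<Rightarrow> real) set)"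
    and "\<And>i. i \<in> {1..N} \<Longrightarrow> regular_compact (K i) \<and> K i \<subseteq> \<Omega>"
    and "unisolvent d N K"
    and "\<And>i j. i \<in> {1..N} \<Longrightarrow> j \<in> {1..N} \<Longrightarrow> i \<noteq> j \<Longrightarrow> K i \<inter> K j = {}"
  shows "interpolator_op_norm \<Omega> d N K = lebesgue_constant \<Omega> d N K"
proof -
  \<comment> \<open>For \<open>N = 0\<close> unisolvence would hold vacuously over no integrals and
    force the constant polynomial 1 to vanish.\<close>
  have "N \<ge> 1"
  proof (rule ccontr)
    assume "\<not> N \<ge> 1"
    then have "(\<lambda>x :: real ^ 'n. 1 :: real) = 0"
      using assms(6) one_in_poly_space[where 'n = 'n, of d] by (auto simp: unisolvent_def)
    then show False by (simp add: fun_eq_iff)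
  qed
  have "compact (K i)" if "i \<in> {1..N}" for i
    using assms(5)[OF that] regular_compactD(1) by blast
  then have "is_lagrange_basis d N K (lagrange_basis d N K)"
    using assms(4,6) by (intro is_lagrange_basis_lagrange_basis)
  \<comment> \<open>The basis functions are polynomials, hence continuous on \<Omega>, as the
    averaging argument requires.\<close>
  then have "lebesgue_constant \<Omega> d N K =
      (SUP \<xi>\<in>\<Omega>. ereal (\<Sum>i=1..N. measure lebesgue (K i) * \<bar>lagrange_basis d N K i \<xi>\<bar>))"
    by (intro lebesgue_constant_eq_pointwise assms(1) poly_space_continuous is_lagrange_basis_poly)
  with interpolator_op_norm_eq_pointwise[OF assms(5) \<open>N \<ge> 1\<close> assms(7)]
  show ?thesis by simp
qed

end
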